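(* Let $\mathcal{F}_4$ be the class of functions $f\in\mathcal{A}$ such that $\left|f'(z)/g'(z)-1\right|<1$ for all $z\in\mathbb{D}$, for some $g\in\mathcal{A}$ with $\operatorname{Re} g'(z)>0$ for all $z\in\mathbb{D}$. Then the following sharp radius results hold (i.e. each radius below is exactly equal to the stated value): (1) for every $0\le\alpha<1$, the $\mathcal{C}(\alpha)$-radius of $\mathcal{F}_4$ is $R_{\mathcal{C}(\alpha)}(\mathcal{F}_4)=\dfrac{2(1-\alpha)}{3+\sqrt{9+4(\alpha-2)(\alpha-1)}}$; (2) the $\mathcal{UCV}$-radius of $\mathcal{F}_4$ is $R_{\mathcal{UCV}}(\mathcal{F}_4)=R_{\mathcal{C}(1/2)}(\mathcal{F}_4)=\dfrac{2\sqrt3-3}{3}$.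
   Context: $\mathbb{D}=\{z\in\mathbb{C}:|z|<1\}$. $\mathcal{A}$ is the class of analytic functions $f$ on $\mathbb{D}$ with $f(0)=0$ and $f'(0)=1$; $\mathcal{S}\subset\mathcal{A}$ is the subclass of univalent (injective) functions. For $0\le\alpha<1$, $\mathcal{C}(\alpha)$ is the class of $f\in\mathcal{S}$ with $\operatorname{Re}(1+zf''(z)/f'(z))>\alpha$ on $\mathbb{D}$ (convex of order $\alpha$). $\mathcal{UCV}$ is the class of uniformly convex functions: $f\in\mathcal{S}$ such that for every circular arc $\gamma\subset\mathbb{D}$ with center $\zeta\in\mathbb{D}$ the image arc $f(\gamma)$ is convex; by a known theorem of Rønning and of Ma and Minda, $f\in\mathcal{UCV}$ if and only if $\operatorname{Re}\left(1+zf''(z)/f'(z)\right)>\left|zf''(z)/f'(z)\right|$ for all $z\in\mathbb{D}$. For families $\mathcal{G},\mathcal{F}\subset\mathcal{A}$, the $\mathcal{G}$-radius of $\mathcal{F}$, denoted $R_{\mathcal{G}}(\mathcal{F})$, is the largest number $R$ such that the function $z\mapsto r^{-1}f(rz)$ belongs to $\mathcal{G}$ for all $0<r\le R$ and all $f\in\mathcal{F}$. *)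

theory Defs
  imports "HOL-Complex_Analysis.Complex_Analysis"
begin

text \<open>Functions on the open unit disc are total functions of type \<^typ>\<open>complex \<Rightarrow> complex\<close>;
  their values outside the disc play no role.\<close>

abbreviation unit_disc :: "complex set" where
  "unit_disc \<equiv> ball 0 1"

definition class_A :: "(complex \<Rightarrow> complex) set" where
  "class_A = {f. f holomorphic_on unit_disc \<and> f 0 = 0 \<and> deriv f 0 = 1}"

definition class_S :: "(complex \<Rightarrow> complex) set" where
  "class_S = {f \<in> class_A. inj_on f unit_disc}"

definition class_C :: "real \<Rightarrow> (complex \<Rightarrow> complex) set" where
  "class_C \<alpha> = {f \<in> class_S. \<forall>z\<in>unit_disc. Re (1 + z * deriv (deriv f) z / deriv f z) > \<alpha>}"

text \<open>An arc \<open>w : [a, b] \<rightarrow> \<complex>\<close> is convex if the argument of its tangent is a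
  nondecreasing function of the parameter. The argument is a continuous branch along the whole arc,
  so it is not confined to an interval of length \<open>2\<pi>\<close>.\<close>

definition convex_arc :: "real \<Rightarrow> real \<Rightarrow> (real \<Rightarrow> complex) \<Rightarrow> bool" where
  "convex_arc a b w \<longleftrightarrow>
     (\<exists>w' \<theta>. (\<forall>t\<in>{a..b}. (w has_vector_derivative w' t) (at t within {a..b}) \<and> w' t \<noteq> 0 \<and>
                 w' t = of_real (norm (w' t)) * cis (\<theta> t)) \<and>
             continuous_on {a..b} \<theta> \<and> mono_on {a..b} \<theta>)"

definition circular_arc :: "complex \<Rightarrow> real \<Rightarrow> real \<Rightarrow> complex" where
  "circular_arc \<zeta> \<rho> t = \<zeta> + of_real \<rho> * cis t"

text \<open>Uniformly convex functions. Arcs are traversed counterclockwise, and full circles are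
  included.\<close>

definition class_UCV :: "(complex \<Rightarrow> complex) set" where
  "class_UCV = {f \<in> class_S. \<forall>\<zeta>\<in>unit_disc. \<forall>\<rho> a b.
      0 < \<rho> \<and> a < b \<and> b \<le> a + 2 * pi \<and> circular_arc \<zeta> \<rho> ` {a..b} \<subseteq> unit_disc \<longrightarrow>
      convex_arc a b (f \<circ> circular_arc \<zeta> \<rho>)}"

definition dilation :: "real \<Rightarrow> (complex \<Rightarrow> complex) \<Rightarrow> complex \<Rightarrow> complex" where
  "dilation r f z = f (of_real r * z) / of_real r"

text \<open>Only \<open>R \<le> 1\<close> is admissible, because \<open>f\<close> has a meaning only on the unit disc.\<close>

definition radius_admissible ::
    "(complex \<Rightarrow> complex) set \<Rightarrow> (complex \<Rightarrow> complex) set \<Rightarrow> real \<Rightarrow> bool" where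
  "radius_admissible G F R \<longleftrightarrow> R \<le> 1 \<and> (\<forall>r. 0 < r \<and> r \<le> R \<longrightarrow> (\<forall>f\<in>F. dilation r f \<in> G))"

text \<open>\<open>is_radius G F R\<close>: the \<open>G\<close>-radius of \<open>F\<close> exists and equals \<open>R\<close>.\<close>

definition is_radius ::
    "(complex \<Rightarrow> complex) set \<Rightarrow> (complex \<Rightarrow> complex) set \<Rightarrow> real \<Rightarrow> bool" where
  "is_radius G F R \<longleftrightarrow> radius_admissible G F R \<and> (\<forall>R'. radius_admissible G F R' \<longrightarrow> R' \<le> R)"

definition class_F4 :: "(complex \<Rightarrow> complex) set" where
  "class_F4 = {f \<in> class_A. \<exists>g\<in>class_A.
      (\<forall>z\<in>unit_disc. Re (deriv g z) > 0) \<and>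
      (\<forall>z\<in>unit_disc. cmod (deriv f z / deriv g z - 1) < 1)}"

end

theory Submission imports Defs begin

text \<open>
  A function \<open>f\<close> of the class satisfies \<open>f' = (1 + w) (1 + h) / (1 - w)\<close> with two
  self-maps \<open>w\<close>, \<open>h\<close> of the disc that fix the origin: \<open>g' = (1 + w) / (1 - w)\<close> because the
  Cayley transform carries the right half-plane to the disc, and \<open>h = f' / g' - 1\<close>. Hence
  \<open>f'' / f' = 2 w' / (1 - w\<^sup>2) + h' / (1 + h)\<close>. The Schwarz--Pick inequality bounds the first
  term by \<open>2 / (1 - r\<^sup>2)\<close> and the second by \<open>(1 + \<bar>h\<bar>) / (1 - r\<^sup>2) \<le> (1 + r) / (1 - r\<^sup>2)\<close>,
  where \<open>r = \<bar>z\<bar>\<close>, so that \<open>\<bar>f'' / f'\<bar> \<le> (3 + r) / (1 - r\<^sup>2)\<close>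
  (\<open>F4_logarithmic_derivative_bound\<close>). Taking \<open>w = h = z\<close>, that is
  \<open>f' = (1 + z)\<^sup>2 / (1 - z)\<close>, gives equality at every point of the negative radius, and there
  \<open>z f'' / f'\<close> is real and negative (\<open>F4_extremal_dilation\<close>).

  Convexity of order \<open>\<alpha>\<close> asks for \<open>Re (z f'' / f') > \<alpha> - 1\<close>. The bound guarantees it as long as
  \<open>r (3 + r) / (1 - r\<^sup>2) < 1 - \<alpha>\<close>, and the extremal function violates it at the radius of
  equality. The radius is therefore the positive root \<open>R\<close> of the quadratic equation
  \<open>R (3 + R) = (1 - \<alpha>) (1 - R\<^sup>2)\<close>, which is the stated expression
  (\<open>F4_radius_formula\<close>).

  Uniform convexity amounts to \<open>Re (1 + (z - \<zeta>) F'' / F') \<ge> 0\<close> for all \<open>z\<close>, \<open>\<zeta>\<close> in the disc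
  (\<open>class_UCV_iff\<close>): this quantity is the speed at which the tangent of the image of a circle
  about \<open>\<zeta>\<close> turns at \<open>z\<close>. Let \<open>R\<close> be the radius for \<open>\<alpha> = 1 / 2\<close> and \<open>F\<close> a dilation of \<open>f\<close> by
  at most \<open>R\<close>. Then \<open>\<bar>F'' / F'\<bar> \<le> R (3 + R) / (1 - R\<^sup>2) = 1 / 2\<close>, whereas \<open>\<bar>z - \<zeta>\<bar> \<le> 2\<close>, so the
  condition holds. Conversely \<open>\<zeta> = - z\<close> turns it into \<open>Re (z F'' / F') \<ge> - 1 / 2\<close>, which the
  extremal function violates beyond \<open>R\<close>. Thus the two radii agree.

  Membership in each of the classes also needs univalence. All radii are at most \<open>1 / 3\<close>, and
  \<open>Re f' > 0\<close> on that disc (\<open>F4_Re_deriv_pos\<close>), which suffices.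
\<close>

section \<open>Schwarz--Pick and univalence\<close>

text \<open>
  Moving \<open>z\<close> and \<open>\<phi> z\<close> to the origin by disc automorphisms turns \<open>\<phi>\<close> into a self-map that fixes
  the origin; the Schwarz lemma for its derivative there is the inequality.
\<close>

lemma Schwarz_Pick:
  assumes hol: "\<phi> holomorphic_on ball 0 1"
    and bound: "\<And>z. norm z < 1 \<Longrightarrow> norm (\<phi> z) < 1"
    and z: "norm z < 1"
  shows "norm (deriv \<phi> z) * (1 - (norm z)\<^sup>2) \<le> 1 - (norm (\<phi> z))\<^sup>2"
proof -
  let ?m = "Moebius_function 0 (- z)"
  let ?M = "Moebius_function 0 (\<phi> z)"
  let ?G = "?M \<circ> \<phi> \<circ> ?m"
  have pz: "norm (\<phi> z) < 1" using bound z by blast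
  have m0: "?m 0 = z" by (simp add: Moebius_function_of_zero)
  have mb: "norm (?m u) < 1" if "norm u < 1" for u
    using Moebius_function_norm_lt_1[of "- z" u 0] z that by simp
  have "?m holomorphic_on ball 0 1" by (rule Moebius_function_holomorphic) (use z in simp)
  then have hG: "?G holomorphic_on ball 0 1"
    by (auto simp: mb bound intro!: holomorphic_on_compose_gen[of _ _ _ "ball 0 1"] hol
        Moebius_function_holomorphic[OF pz])
  have G0: "?G 0 = 0" using m0 by (simp add: Moebius_function_eq_zero)
  have Gb: "norm (?G u) < 1" if "norm u < 1" for u
    using Moebius_function_norm_lt_1[OF pz bound[OF mb[OF that]]] by simp
  have nn: "1 - (norm a)\<^sup>2 > 0" if "norm a < 1" for a :: complex
    using that by (simp add: power_less_one_iff)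
  have cn: "1 - cnj a * a = of_real (1 - (norm a)\<^sup>2)" for a
    by (metis complex_norm_square mult.commute of_real_1 of_real_diff)
  have d1: "(?m has_field_derivative of_real (1 - (norm z)\<^sup>2)) (at 0)"
    unfolding Moebius_function_def
    by (rule derivative_eq_intros refl | simp)+ (simp add: complex_norm_square[symmetric] flip: of_real_power)
  have d2: "(\<phi> has_field_derivative deriv \<phi> z) (at (?m 0))"
    unfolding m0 using hol z by (auto intro!: holomorphic_derivI[of _ "ball 0 1"])
  have ne: "1 - cnj (\<phi> z) * \<phi> z \<noteq> 0"
    using nn[OF pz] unfolding cn by (simp only: of_real_eq_0_iff)
  have d3: "(?M has_field_derivative 1 / of_real (1 - (norm (\<phi> z))\<^sup>2)) (at ((\<phi> \<circ> ?m) 0))"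
  proof -
    have "((\<lambda>u. (u - \<phi> z) / (1 - cnj (\<phi> z) * u)) has_field_derivative
        1 / (1 - cnj (\<phi> z) * \<phi> z)) (at (\<phi> z))"
      using ne by (auto intro!: derivative_eq_intros simp: divide_simps)
    then show ?thesis
      unfolding comp_def m0 cn by (simp add: Moebius_function_def[abs_def])
  qed
  have "(?G has_field_derivative 1 / of_real (1 - (norm (\<phi> z))\<^sup>2) *
      (deriv \<phi> z * of_real (1 - (norm z)\<^sup>2))) (at 0)"
    unfolding comp_assoc by (rule DERIV_chain[OF d3 DERIV_chain[OF d2 d1]])
  then have dG: "deriv ?G 0 = 1 / of_real (1 - (norm (\<phi> z))\<^sup>2) * (deriv \<phi> z * of_real (1 - (norm z)\<^sup>2))"
    by (rule DERIV_imp_deriv)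
  have "norm (deriv ?G 0) \<le> 1"
    by (rule Schwarz_Lemma(2)[OF hG G0 Gb, of 0]) auto
  then have "norm (deriv \<phi> z) * (1 - (norm z)\<^sup>2) / (1 - (norm (\<phi> z))\<^sup>2) \<le> 1"
    using nn[OF z] nn[OF pz] unfolding dG norm_mult norm_divide norm_of_real by simp
  then show ?thesis using nn[OF pz] by (simp add: divide_simps)
qed

text \<open>
  The Noshiro--Warschawski criterion: by the mean value theorem on the segment from \<open>x\<close> to \<open>y\<close>, the
  real part of the difference quotient \<open>(f y - f x) / (y - x)\<close> is a value of \<open>Re f'\<close>.
\<close>

lemma inj_on_if_Re_deriv_pos:
  assumes hol: "f holomorphic_on S" and S: "open S" "convex S"
    and pos: "\<And>z. z \<in> S \<Longrightarrow> Re (deriv f z) > 0"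
  shows "inj_on f S"
proof (rule inj_onI, rule ccontr)
  fix x y assume xy: "x \<in> S" "y \<in> S" "f x = f y" "x \<noteq> y"
  have seg: "closed_segment x y \<subseteq> S" using xy S by (simp add: closed_segment_subset)
  have "((\<lambda>z. f z / (y - x)) has_field_derivative deriv f u / (y - x)) (at u)"
    if "u \<in> closed_segment x y" for u
    using that seg hol S(1) by (intro DERIV_cdivide holomorphic_derivI[of _ S]) auto
  then obtain u where u: "u \<in> closed_segment x y"
    "Re (f y / (y - x)) - Re (f x / (y - x)) = Re (deriv f u / (y - x) * (y - x))"
    using complex_mvt_line[of x y "\<lambda>z. f z / (y - x)" "\<lambda>u. deriv f u / (y - x)"] by blast
  then have "Re (deriv f u) = 0" using xy by simp
  with pos u(1) seg show False by force
qed

section \<open>Distortion estimates for the derivative\<close>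

lemma F4_factorization:
  assumes f: "f \<in> class_F4"
  obtains w h where "w holomorphic_on unit_disc" "h holomorphic_on unit_disc" "w 0 = 0" "h 0 = 0"
    "\<And>z. norm z < 1 \<Longrightarrow> norm (w z) < 1" "\<And>z. norm z < 1 \<Longrightarrow> norm (h z) < 1"
    "\<And>z. norm z < 1 \<Longrightarrow> deriv f z = (1 + w z) * (1 + h z) / (1 - w z)"
proof -
  obtain g where g: "g \<in> class_A" and gp: "\<And>z. norm z < 1 \<Longrightarrow> Re (deriv g z) > 0"
    and fg: "\<And>z. norm z < 1 \<Longrightarrow> norm (deriv f z / deriv g z - 1) < 1"
    using f by (auto simp: class_F4_def)
  have fA: "f \<in> class_A" using f by (simp add: class_F4_def)
  define w where "w z = (deriv g z - 1) / (deriv g z + 1)" for z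
  define h where "h z = deriv f z / deriv g z - 1" for z
  have hol: "deriv f holomorphic_on unit_disc" "deriv g holomorphic_on unit_disc"
    using fA g by (auto simp: class_A_def intro!: holomorphic_deriv)
  have n0: "deriv g z \<noteq> 0" "deriv g z + 1 \<noteq> 0" if "norm z < 1" for z
    using gp[OF that] by (auto simp: complex_eq_iff)
  have wlt: "norm (w z) < 1" if "norm z < 1" for z
  proof -
    have "(norm (deriv g z - 1))\<^sup>2 < (norm (deriv g z + 1))\<^sup>2"
      unfolding cmod_power2 using gp[OF that] by (simp add: power2_eq_square algebra_simps)
    then have "norm (deriv g z - 1) < norm (deriv g z + 1)"
      by (rule power2_less_imp_less) simp
    then show ?thesis by (simp add: w_def norm_divide divide_simps n0[OF that])
  qed
  have eq: "deriv f z = (1 + w z) * (1 + h z) / (1 - w z)" if "norm z < 1" for z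
  proof -
    have "1 + w z = 2 * deriv g z / (deriv g z + 1)" "1 - w z = 2 / (deriv g z + 1)"
      using n0[OF that] by (simp_all add: w_def divide_simps)
    then have "(1 + w z) / (1 - w z) = deriv g z" using n0[OF that] by simp
    moreover have "deriv f z = deriv g z * (1 + h z)"
      using n0[OF that] by (simp add: h_def)
    ultimately show ?thesis by (metis times_divide_eq_left)
  qed
  show thesis
  proof (rule that[OF _ _ _ _ wlt _ eq])
    show "w holomorphic_on unit_disc" "h holomorphic_on unit_disc"
      unfolding w_def h_def using n0 by (auto intro!: holomorphic_intros hol)
    show "w 0 = 0" "h 0 = 0" using fA g by (auto simp: w_def h_def class_A_def)
    show "norm (h z) < 1" if "norm z < 1" for z using fg[OF that] by (simp add: h_def)
  qed auto
qed

text \<open>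
  Each factor of \<open>f' = (1 + w) (1 + h) / (1 - w)\<close> contributes a summand to \<open>f'' / f'\<close>; those of
  \<open>1 + w\<close> and \<open>1 - w\<close> are combined first, because the numerator \<open>1 - \<bar>w\<bar>\<^sup>2\<close> that Schwarz--Pick
  supplies is then at most the denominator \<open>\<bar>1 - w\<^sup>2\<bar>\<close>. For \<open>h\<close> alone the
  factor \<open>1 + \<bar>h\<bar>\<close> remains, and the Schwarz lemma bounds it by \<open>1 + r\<close>.
\<close>

lemma F4_logarithmic_derivative_bound:
  assumes f: "f \<in> class_F4" and z: "norm z < 1"
  shows "norm (deriv (deriv f) z / deriv f z) \<le> (3 + norm z) / (1 - (norm z)\<^sup>2)"
proof -
  obtain w h where hol: "w holomorphic_on unit_disc" "h holomorphic_on unit_disc"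
    and "w 0 = 0" and h0: "h 0 = 0" and wb: "\<And>z. norm z < 1 \<Longrightarrow> norm (w z) < 1"
    and hb: "\<And>z. norm z < 1 \<Longrightarrow> norm (h z) < 1"
    and eq: "\<And>z. norm z < 1 \<Longrightarrow> deriv f z = (1 + w z) * (1 + h z) / (1 - w z)"
    using F4_factorization[OF f] by blast
  let ?r = "norm z"
  have r1: "1 - ?r\<^sup>2 > 0" using z by (simp add: power_less_one_iff)
  have ne: "1 + w z \<noteq> 0" "1 - w z \<noteq> 0" "1 + h z \<noteq> 0"
    using wb[OF z] hb[OF z] by (auto simp: add_eq_0_iff)
  have dw: "(w has_field_derivative deriv w z) (at z)" and dh: "(h has_field_derivative deriv h z) (at z)"
    using hol z by (auto intro!: holomorphic_derivI[of _ "ball 0 1"])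
  have "((\<lambda>z. (1 + w z) * (1 + h z) / (1 - w z)) has_field_derivative
     ((deriv w z * (1 + h z) + (1 + w z) * deriv h z) * (1 - w z) + (1 + w z) * (1 + h z) * deriv w z)
       / (1 - w z)\<^sup>2) (at z)"
    using ne by (auto intro!: derivative_eq_intros dw dh simp: power2_eq_square algebra_simps)
  then have "(deriv f has_field_derivative
     ((deriv w z * (1 + h z) + (1 + w z) * deriv h z) * (1 - w z) + (1 + w z) * (1 + h z) * deriv w z)
       / (1 - w z)\<^sup>2) (at z)"
    by (rule has_field_derivative_transform_within_open[of _ _ _ "ball 0 1"]) (use z eq in auto)
  then have "deriv (deriv f) z =
     ((deriv w z * (1 + h z) + (1 + w z) * deriv h z) * (1 - w z) + (1 + w z) * (1 + h z) * deriv w z)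
       / (1 - w z)\<^sup>2"
    by (rule DERIV_imp_deriv)
  then have L: "deriv (deriv f) z / deriv f z = 2 * deriv w z / (1 - (w z)\<^sup>2) + deriv h z / (1 + h z)"
  proof -
    have A: "\<And>w h w' h' :: complex. 1 + w \<noteq> 0 \<Longrightarrow> 1 - w \<noteq> 0 \<Longrightarrow> 1 + h \<noteq> 0 \<Longrightarrow>
      ((w' * (1 + h) + (1 + w) * h') * (1 - w) + (1 + w) * (1 + h) * w') / (1 - w)\<^sup>2 /
      ((1 + w) * (1 + h) / (1 - w)) = 2 * w' / ((1 - w) * (1 + w)) + h' / (1 + h)"
      by (simp add: divide_simps power2_eq_square) (simp add: algebra_simps)
    have "1 - (w z)\<^sup>2 = (1 - w z) * (1 + w z)" by (simp add: power2_eq_square algebra_simps)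
    then show ?thesis using A[OF ne] \<open>deriv (deriv f) z = _\<close> eq[OF z] by metis
  qed
  have wp: "1 - (norm (w z))\<^sup>2 > 0" using wb[OF z] by (simp add: power_less_one_iff)
  have "1 - (norm (w z))\<^sup>2 \<le> norm (1 - (w z)\<^sup>2)"
    using norm_triangle_ineq2[of 1 "(w z)\<^sup>2"] by (simp add: norm_power)
  then have "norm (2 * deriv w z / (1 - (w z)\<^sup>2)) \<le> 2 * norm (deriv w z) / (1 - (norm (w z))\<^sup>2)"
    unfolding norm_divide norm_mult using wp by (intro frac_le) auto
  also have "\<dots> \<le> 2 / (1 - ?r\<^sup>2)"
    using Schwarz_Pick[OF hol(1) wb z] r1 wp by (simp add: divide_simps algebra_simps)
  finally have 1: "norm (2 * deriv w z / (1 - (w z)\<^sup>2)) \<le> 2 / (1 - ?r\<^sup>2)" .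
  have hp: "1 - norm (h z) > 0" using hb[OF z] by simp
  have "1 - norm (h z) \<le> norm (1 + h z)"
    using norm_triangle_ineq2[of 1 "- h z"] by simp
  then have "norm (deriv h z / (1 + h z)) \<le> norm (deriv h z) / (1 - norm (h z))"
    unfolding norm_divide using hp by (intro frac_le) auto
  also have "\<dots> \<le> (1 + norm (h z)) / (1 - ?r\<^sup>2)"
    using Schwarz_Pick[OF hol(2) hb z] r1 hp
    by (simp add: divide_simps mult.commute power2_eq_square algebra_simps)
  also have "\<dots> \<le> (1 + ?r) / (1 - ?r\<^sup>2)"
    using Schwarz_Lemma(1)[OF hol(2) h0 hb z] r1 by (intro divide_right_mono) auto
  finally have 2: "norm (deriv h z / (1 + h z)) \<le> (1 + ?r) / (1 - ?r\<^sup>2)" .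
  have "norm (deriv (deriv f) z / deriv f z) \<le> 2 / (1 - ?r\<^sup>2) + (1 + ?r) / (1 - ?r\<^sup>2)"
    unfolding L by (rule norm_triangle_mono[OF 1 2])
  then show ?thesis by (simp add: add_divide_distrib[symmetric])
qed

text \<open>
  Up to the positive factor \<open>1 / \<bar>1 - w\<bar>\<^sup>2\<close>, the derivative is \<open>q (1 + h)\<close> with
  \<open>q = (1 + w) (1 - cnj w)\<close>. Here \<open>Re q = 1 - \<bar>w\<bar>\<^sup>2\<close> and \<open>\<bar>q\<bar> \<le> 1 + \<bar>w\<bar>\<^sup>2\<close>, so for
  \<open>\<bar>w\<bar>, \<bar>h\<bar> \<le> 1 / 3\<close> the real part is at least \<open>8 / 9 - 10 / 27 > 0\<close>.
\<close>

lemma F4_Re_deriv_pos: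
  assumes f: "f \<in> class_F4" and z: "norm z \<le> 1 / 3"
  shows "Re (deriv f z) > 0"
proof -
  obtain w h where hol: "w holomorphic_on unit_disc" "h holomorphic_on unit_disc"
    and w0: "w 0 = 0" and h0: "h 0 = 0" and wb: "\<And>z. norm z < 1 \<Longrightarrow> norm (w z) < 1"
    and hb: "\<And>z. norm z < 1 \<Longrightarrow> norm (h z) < 1"
    and eq: "\<And>z. norm z < 1 \<Longrightarrow> deriv f z = (1 + w z) * (1 + h z) / (1 - w z)"
    using F4_factorization[OF f] by blast
  have z1: "norm z < 1" using z by simp
  have w3: "norm (w z) \<le> 1/3" and h3: "norm (h z) \<le> 1/3"
    using Schwarz_Lemma(1)[OF hol(1) w0 wb z1] Schwarz_Lemma(1)[OF hol(2) h0 hb z1] z by auto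
  let ?q = "(1 + w z) * (1 - cnj (w z))"
  have ne: "1 - w z \<noteq> 0" using w3 by auto
  have w9: "(norm (w z))\<^sup>2 \<le> 1/9" using power_mono[OF w3, of 2] by (simp add: power_divide)
  have "Re ?q = 1 - (norm (w z))\<^sup>2"
    unfolding cmod_power2 by (simp add: power2_eq_square algebra_simps)
  then have req: "Re ?q \<ge> 8/9" using w9 by simp
  have "norm ?q = norm ((1 + w z) * (1 - w z))"
    by (metis complex_cnj_diff complex_cnj_one complex_mod_cnj norm_mult)
  also have "\<dots> = norm (1 - (w z)\<^sup>2)" by (simp add: power2_eq_square algebra_simps)
  also have "\<dots> \<le> 1 + (norm (w z))\<^sup>2" by (metis norm_one norm_power norm_triangle_ineq4)
  finally have nq: "norm ?q \<le> 10/9" using w9 by simp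
  have "norm (?q * h z) \<le> 10/9 * (1/3)" unfolding norm_mult[of ?q]
    by (intro mult_mono nq h3) auto
  then have "Re (?q * h z) \<ge> - (10/27)" using abs_Re_le_cmod[of "?q * h z"] by linarith
  then have pos: "Re (?q * (1 + h z)) > 0" using req by (simp only: distrib_left plus_complex.simps mult_1_right)
  have "(norm (1 - w z))\<^sup>2 > 0" using ne by simp
  moreover have "deriv f z = ?q * (1 + h z) / of_real ((norm (1 - w z))\<^sup>2)"
    unfolding eq[OF z1] complex_norm_square using ne by (simp add: divide_simps)
  ultimately show ?thesis using pos by (simp only: Re_divide_of_real) simp
qed


section \<open>Dilations\<close>

lemma dilation_class_A:
  assumes f: "f \<in> class_A" and r: "0 < r" "r \<le> 1"
  shows "dilation r f \<in> class_A"
    and "norm z < 1 \<Longrightarrow> deriv (dilation r f) z = deriv f (of_real r * z)"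
    and "norm z < 1 \<Longrightarrow> deriv (deriv (dilation r f)) z = of_real r * deriv (deriv f) (of_real r * z)"
proof -
  have hol: "f holomorphic_on unit_disc" using f by (simp add: class_A_def)
  have in_disc: "norm (of_real r * z) < 1" if "norm z < 1" for z :: complex
    using that r mult_le_less_imp_less[of r 1 "norm z" 1] by (simp add: norm_mult)
  have D: "(dilation r f has_field_derivative deriv f (of_real r * z)) (at z)" if "norm z < 1" for z
  proof -
    have "(f has_field_derivative deriv f (of_real r * z)) (at (of_real r * z))"
      using hol in_disc[OF that] by (auto intro!: holomorphic_derivI[of _ "ball 0 1"])
    from DERIV_chain2[OF this DERIV_cmult_Id] have
      "((\<lambda>z. f (of_real r * z) / of_real r) has_field_derivative deriv f (of_real r * z) * of_real r / of_real r) (at z)"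
      by (rule DERIV_cdivide)
    then show ?thesis using r by (simp add: dilation_def[abs_def])
  qed
  then show d: "deriv (dilation r f) z = deriv f (of_real r * z)" if "norm z < 1" for z
    using DERIV_imp_deriv that by blast
  have "(deriv (dilation r f) has_field_derivative deriv (deriv f) (of_real r * z) * of_real r) (at z)"
    if "norm z < 1" for z
  proof (rule has_field_derivative_transform_within_open[of _ _ _ "ball 0 1"])
    have "(deriv f has_field_derivative deriv (deriv f) (of_real r * z)) (at (of_real r * z))"
      using hol in_disc[OF that]
      by (intro holomorphic_derivI[of _ "ball 0 1"] holomorphic_deriv) auto
    from DERIV_chain2[OF this DERIV_cmult_Id]
    show "((\<lambda>z. deriv f (of_real r * z)) has_field_derivative deriv (deriv f) (of_real r * z) * of_real r) (at z)" .
  qed (use that d in auto)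
  then show "norm z < 1 \<Longrightarrow> deriv (deriv (dilation r f)) z = of_real r * deriv (deriv f) (of_real r * z)"
    by (metis DERIV_imp_deriv mult.commute)
  have "dilation r f holomorphic_on unit_disc"
    using D by (metis holomorphic_on_open open_ball mem_ball_0)
  moreover have "dilation r f 0 = 0" "deriv (dilation r f) 0 = 1"
    using f d[of 0] by (auto simp: class_A_def dilation_def)
  ultimately show "dilation r f \<in> class_A" by (simp add: class_A_def)
qed

lemma F4_dilation_class_S:
  assumes f: "f \<in> class_F4" and r: "0 < r" "r \<le> 1 / 3"
  shows "dilation r f \<in> class_S"
proof -
  have fA: "f \<in> class_A" using f by (simp add: class_F4_def)
  note dil = dilation_class_A[OF fA r(1)]
  have "inj_on (dilation r f) unit_disc"
  proof (rule inj_on_if_Re_deriv_pos)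
    show "dilation r f holomorphic_on unit_disc" using dil(1) r by (simp add: class_A_def)
    fix z :: complex assume z: "z \<in> unit_disc"
    have "norm (of_real r * z) \<le> 1 / 3"
      using z r mult_mono[of r "1/3" "norm z" 1] by (simp add: norm_mult)
    then show "Re (deriv (dilation r f) z) > 0"
      using F4_Re_deriv_pos[OF f] dil(2) r z by simp
  qed auto
  then show ?thesis using dil(1) r by (simp add: class_S_def)
qed

section \<open>Uniform convexity in terms of the logarithmic derivative\<close>

lemma circular_arc_has_vector_derivative:
  "(circular_arc \<zeta> \<rho> has_vector_derivative \<i> * (circular_arc \<zeta> \<rho> t - \<zeta>)) (at t within S)"
proof -
  have "(cis has_vector_derivative (\<i> * cis t)) (at t within S)"
    unfolding has_vector_derivative_def by (rule derivative_eq_intros refl | simp)+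
  then have "((\<lambda>t. \<zeta> + of_real \<rho> * cis t) has_vector_derivative 0 + of_real \<rho> * (\<i> * cis t)) (at t within S)"
    by (intro derivative_intros has_vector_derivative_mult_right)
  then show ?thesis by (simp add: circular_arc_def[abs_def] algebra_simps)
qed

lemma circular_arc_image_has_vector_derivative:
  assumes "(F has_field_derivative F') (at (circular_arc \<zeta> \<rho> t))"
  shows "((F \<circ> circular_arc \<zeta> \<rho>) has_vector_derivative \<i> * (circular_arc \<zeta> \<rho> t - \<zeta>) * F') (at t within S)"
  by (rule field_vector_diff_chain_within[OF circular_arc_has_vector_derivative])
     (rule has_field_derivative_at_within[OF assms])

text \<open>
  The tangent of the image arc is \<open>\<i> (z - \<zeta>) F' z\<close> at \<open>z = \<zeta> + \<rho> cis t\<close>. On the disc \<open>F'\<close> has a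
  holomorphic logarithm \<open>l\<close>, so \<open>Im (l z) + t + pi / 2\<close> is a continuous branch of the argument of the
  tangent along the whole arc, even when that argument varies by more than \<open>2 * pi\<close>. Its derivative
  is the quantity assumed to be nonnegative.
\<close>

lemma convex_arc_if_curvature_nonneg:
  assumes hol: "F holomorphic_on unit_disc"
    and ne: "\<And>z. z \<in> unit_disc \<Longrightarrow> deriv F z \<noteq> 0"
    and curv: "\<And>z. z \<in> unit_disc \<Longrightarrow> Re (1 + (z - \<zeta>) * deriv (deriv F) z / deriv F z) \<ge> 0"
    and \<rho>: "\<rho> > 0" and arc: "circular_arc \<zeta> \<rho> ` {a..b} \<subseteq> unit_disc"
  shows "convex_arc a b (F \<circ> circular_arc \<zeta> \<rho>)"
proof -
  let ?c = "circular_arc \<zeta> \<rho>"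
  have hol': "deriv F holomorphic_on unit_disc" using hol by (simp add: holomorphic_deriv)
  obtain l where l: "l holomorphic_on unit_disc" "\<And>z. z \<in> unit_disc \<Longrightarrow> deriv F z = exp (l z)"
    using contractible_imp_holomorphic_log[OF hol' convex_imp_contractible[OF convex_ball] ne] by blast
  have dl: "(l has_field_derivative deriv (deriv F) z / deriv F z) (at z)" if z: "z \<in> unit_disc" for z
  proof -
    have d: "(l has_field_derivative deriv l z) (at z)"
      using l(1) z by (auto intro!: holomorphic_derivI[of _ "ball 0 1"])
    have "((\<lambda>z. exp (l z)) has_field_derivative exp (l z) * deriv l z) (at z)"
      by (rule derivative_eq_intros d refl)+
    then have "(deriv F has_field_derivative exp (l z) * deriv l z) (at z)"
      by (rule has_field_derivative_transform_within_open[of _ _ _ "ball 0 1"]) (use z l(2) in auto)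
    then have "deriv (deriv F) z = deriv F z * deriv l z"
      unfolding l(2)[OF z] by (rule DERIV_imp_deriv)
    then show ?thesis using d ne[OF z] by simp
  qed
  define w' where "w' t = \<i> * (?c t - \<zeta>) * deriv F (?c t)" for t
  define \<theta> where "\<theta> t = Im (l (?c t)) + t + pi / 2" for t
  have cin: "?c t \<in> unit_disc" if "t \<in> {a..b}" for t using that arc by blast
  have "(\<theta> has_real_derivative Re (1 + (?c t - \<zeta>) * deriv (deriv F) (?c t) / deriv F (?c t))) (at t)"
    if t: "t \<in> {a..b}" for t
  proof -
    have "((\<lambda>t. Im ((l \<circ> ?c) t)) has_real_derivative
        Im (\<i> * (?c t - \<zeta>) * (deriv (deriv F) (?c t) / deriv F (?c t)))) (at t)"
      unfolding has_real_derivative_iff_has_vector_derivative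
      by (rule bounded_linear.has_vector_derivative[OF bounded_linear_Im
            circular_arc_image_has_vector_derivative[OF dl[OF cin[OF t]]]])
    then have "((\<lambda>t. Im ((l \<circ> ?c) t) + t + pi / 2) has_real_derivative
        Im (\<i> * (?c t - \<zeta>) * (deriv (deriv F) (?c t) / deriv F (?c t))) + 1 + 0) (at t)"
      by (intro DERIV_add DERIV_ident DERIV_const)
    moreover have "\<i> * (?c t - \<zeta>) * (deriv (deriv F) (?c t) / deriv F (?c t)) =
        \<i> * ((?c t - \<zeta>) * deriv (deriv F) (?c t) / deriv F (?c t))"
      by simp
    ultimately show ?thesis
      by (simp only: \<theta>_def[abs_def] comp_def Im_i_times plus_complex.sel one_complex.sel add.commute add_0_left)
  qed
  note d\<theta> = this
  have cont: "continuous_on {a..b} \<theta>"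
    by (rule DERIV_continuous_on) (rule has_field_derivative_at_within[OF d\<theta>])
  have mono: "mono_on {a..b} \<theta>"
  proof (rule mono_onI)
    fix s t assume "s \<in> {a..b}" "t \<in> {a..b}" "s \<le> t"
    then have "s \<le> t" and sub: "\<And>x. s \<le> x \<Longrightarrow> x \<le> t \<Longrightarrow> x \<in> {a..b}" by auto
    then show "\<theta> s \<le> \<theta> t"
      using d\<theta>[OF sub] curv[OF cin[OF sub]] by (blast intro: DERIV_nonneg_imp_nondecreasing)
  qed
  have "((F \<circ> ?c) has_vector_derivative w' t) (at t within {a..b}) \<and> w' t \<noteq> 0 \<and>
      w' t = of_real (norm (w' t)) * cis (\<theta> t)" if t: "t \<in> {a..b}" for t
  proof (intro conjI)
    have "(F has_field_derivative deriv F (?c t)) (at (?c t))"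
      using hol cin[OF t] by (intro holomorphic_derivI[of _ "ball 0 1"]) auto
    then show "((F \<circ> ?c) has_vector_derivative w' t) (at t within {a..b})"
      unfolding w'_def by (rule circular_arc_image_has_vector_derivative)
    show "w' t \<noteq> 0" using ne[OF cin[OF t]] \<rho> by (simp add: w'_def circular_arc_def)
    have "w' t = of_real (\<rho> * exp (Re (l (?c t)))) * cis (\<theta> t)"
      unfolding w'_def l(2)[OF cin[OF t]] \<theta>_def
      by (simp add: circular_arc_def exp_eq_polar flip: cis_mult)
    moreover from this have "norm (w' t) = \<rho> * exp (Re (l (?c t)))"
      using \<rho> by (simp add: norm_mult)
    ultimately show "w' t = of_real (norm (w' t)) * cis (\<theta> t)" by simp
  qed
  with cont mono show ?thesis unfolding convex_arc_def by blast
qed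

text \<open>
  A nondecreasing branch \<open>\<theta>\<close> of the argument of the tangent \<open>v\<close> forces
  \<open>Im (v t / v t0) = \<bar>v t / v t0\<bar> * sin (\<theta> t - \<theta> t0)\<close> to be nonnegative for \<open>t\<close> slightly above
  \<open>t0\<close>, whichever branch it is. The left-hand side vanishes at \<open>t0\<close>, and its derivative there is the
  quantity in the conclusion, which therefore cannot be negative.
\<close>

lemma curvature_nonneg_if_convex_arc:
  assumes hol: "F holomorphic_on unit_disc"
    and ne: "deriv F (circular_arc \<zeta> \<rho> t0) \<noteq> 0"
    and \<rho>: "\<rho> > 0" and arc: "circular_arc \<zeta> \<rho> ` {a..b} \<subseteq> unit_disc"
    and t0: "a < t0" "t0 < b"
    and convex: "convex_arc a b (F \<circ> circular_arc \<zeta> \<rho>)"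
  shows "Re (1 + (circular_arc \<zeta> \<rho> t0 - \<zeta>) * deriv (deriv F) (circular_arc \<zeta> \<rho> t0)
    / deriv F (circular_arc \<zeta> \<rho> t0)) \<ge> 0"
proof (rule ccontr)
  let ?c = "circular_arc \<zeta> \<rho>"
  let ?z = "?c t0"
  assume "\<not> ?thesis"
  then have neg: "Re (1 + (?z - \<zeta>) * deriv (deriv F) ?z / deriv F ?z) < 0" by simp
  define v where "v t = \<i> * (?c t - \<zeta>) * deriv F (?c t)" for t
  have cin: "?c t \<in> unit_disc" if "t \<in> {a..b}" for t using that arc by blast
  have t0': "t0 \<in> {a..b}" using t0 by simp
  have dF: "((F \<circ> ?c) has_vector_derivative v t) (at t within {a..b})" if "t \<in> {a..b}" for t
    unfolding v_def using hol cin[OF that]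
    by (intro circular_arc_image_has_vector_derivative holomorphic_derivI[of _ "ball 0 1"]) auto
  have cz: "?z - \<zeta> \<noteq> 0" using \<rho> by (simp add: circular_arc_def)
  have v0: "v t0 \<noteq> 0" using ne cz by (simp add: v_def)
  have d': "(deriv F has_field_derivative deriv (deriv F) ?z) (at ?z)"
    using hol cin[OF t0'] by (intro holomorphic_derivI[of _ "ball 0 1"] holomorphic_deriv) auto
  have "((\<lambda>z. \<i> * (z - \<zeta>) * deriv F z) has_field_derivative
      \<i> * deriv F ?z + \<i> * (?z - \<zeta>) * deriv (deriv F) ?z) (at ?z)"
    by (rule derivative_eq_intros d' refl | simp)+
  from circular_arc_image_has_vector_derivative[OF this, of UNIV]
  have "(v has_vector_derivative \<i> * (?z - \<zeta>) *
     (\<i> * deriv F ?z + \<i> * (?z - \<zeta>) * deriv (deriv F) ?z)) (at t0)"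
    by (simp add: v_def[abs_def] comp_def)
  from has_vector_derivative_divide[OF this, of "v t0"]
  have "((\<lambda>t. v t / v t0) has_vector_derivative
      \<i> * (1 + (?z - \<zeta>) * deriv (deriv F) ?z / deriv F ?z)) (at t0)"
    using cz ne by (simp add: v_def divide_simps) (simp add: algebra_simps)
  from bounded_linear.has_vector_derivative[OF bounded_linear_Im this]
  have "((\<lambda>t. Im (v t / v t0)) has_real_derivative
      Re (1 + (?z - \<zeta>) * deriv (deriv F) ?z / deriv F ?z)) (at t0)"
    unfolding has_real_derivative_iff_has_vector_derivative by simp
  from DERIV_neg_dec_right[OF this neg] v0 obtain d where d: "d > 0"
    and dec: "\<And>h. 0 < h \<Longrightarrow> h < d \<Longrightarrow> Im (v (t0 + h) / v t0) < 0" by auto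
  obtain w' \<theta> where w': "\<And>t. t \<in> {a..b} \<Longrightarrow> ((F \<circ> ?c) has_vector_derivative w' t) (at t within {a..b})"
    and polar: "\<And>t. t \<in> {a..b} \<Longrightarrow> w' t = of_real (norm (w' t)) * cis (\<theta> t)"
    and cont: "continuous_on {a..b} \<theta>" and mono: "mono_on {a..b} \<theta>"
    using convex unfolding convex_arc_def by blast
  have w'v: "w' t = v t" if "t \<in> {a..b}" for t
    using vector_derivative_unique_within_closed_interval[of a b t] w'[OF that] dF[OF that] t0 that by auto
  have "isCont \<theta> t0" using cont t0 by (simp add: continuous_on_interior)
  then obtain e where e: "e > 0" "\<And>t. dist t t0 < e \<Longrightarrow> dist (\<theta> t) (\<theta> t0) < pi"
    unfolding continuous_at_eps_delta using pi_gt_zero by (metis dist_norm real_norm_def)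
  define h where "h = min (min (d/2) (e/2)) (b - t0)"
  have h: "0 < h" "h < d" "h < e" "t0 + h \<in> {a..b}" using d e(1) t0 by (auto simp: h_def min_def)
  have "\<theta> t0 \<le> \<theta> (t0 + h)" using mono_onD[OF mono t0' h(4)] h by simp
  moreover have "\<theta> (t0 + h) - \<theta> t0 < pi" using e(2)[of "t0 + h"] h by (simp add: dist_real_def)
  ultimately have sin: "sin (\<theta> (t0 + h) - \<theta> t0) \<ge> 0" by (intro sin_ge_zero) auto
  have "v (t0 + h) / v t0 = of_real (norm (v (t0 + h))) * cis (\<theta> (t0 + h)) / (of_real (norm (v t0)) * cis (\<theta> t0))"
    using polar[OF h(4)] polar[OF t0'] unfolding w'v[OF h(4)] w'v[OF t0'] by simp
  also have "\<dots> = of_real (norm (v (t0 + h)) / norm (v t0)) * cis (\<theta> (t0 + h) - \<theta> t0)"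
    by (simp add: cis_divide[symmetric])
  finally have "Im (v (t0 + h) / v t0) = norm (v (t0 + h)) / norm (v t0) * sin (\<theta> (t0 + h) - \<theta> t0)"
    by (simp only: times_complex.sel Re_complex_of_real Im_complex_of_real cis.sel)
  then have "Im (v (t0 + h) / v t0) \<ge> 0" using sin by simp
  with dec[OF h(1,2)] show False by simp
qed

text \<open>
  For the forward direction, given \<open>z \<noteq> \<zeta>\<close>, a short arc about \<open>\<zeta>\<close> with \<open>z\<close> in its interior is
  used: the full circle need not lie in the disc.
\<close>

lemma class_UCV_iff:
  "F \<in> class_UCV \<longleftrightarrow> F \<in> class_S \<and>
    (\<forall>\<zeta>\<in>unit_disc. \<forall>z\<in>unit_disc. Re (1 + (z - \<zeta>) * deriv (deriv F) z / deriv F z) \<ge> 0)"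
proof (cases "F \<in> class_S")
  case True
  then have hol: "F holomorphic_on unit_disc" and inj: "inj_on F unit_disc"
    by (auto simp: class_S_def class_A_def)
  have ne: "deriv F z \<noteq> 0" if "z \<in> unit_disc" for z
    using holomorphic_injective_imp_regular[OF hol _ inj that] by simp
  show ?thesis
  proof (intro iffI conjI ballI)
    fix \<zeta> z :: complex assume U: "F \<in> class_UCV" and \<zeta>: "\<zeta> \<in> unit_disc" and z: "z \<in> unit_disc"
    show "Re (1 + (z - \<zeta>) * deriv (deriv F) z / deriv F z) \<ge> 0"
    proof (cases "z = \<zeta>")
      case False
      define \<rho> where "\<rho> = norm (z - \<zeta>)"
      define t0 where "t0 = Arg (z - \<zeta>)"
      let ?c = "circular_arc \<zeta> \<rho>"
      have \<rho>: "\<rho> > 0" using False by (simp add: \<rho>_def)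
      have z0: "?c t0 = z" using rcis_cmod_Arg[of "z - \<zeta>"]
        by (simp add: circular_arc_def \<rho>_def t0_def rcis_def)
      have "isCont ?c t0"
        by (rule has_vector_derivative_continuous[OF circular_arc_has_vector_derivative])
      then have "(?c \<longlongrightarrow> z) (nhds t0)"
        by (metis isCont_def tendsto_at_iff_tendsto_nhds z0)
      then have "\<forall>\<^sub>F t in nhds t0. ?c t \<in> unit_disc"
        by (rule topological_tendstoD) (use z in auto)
      then obtain d where d: "d > 0" "\<And>t. dist t t0 < d \<Longrightarrow> ?c t \<in> unit_disc"
        unfolding eventually_nhds_metric by blast
      define e where "e = min (d/2) pi"
      have e: "e > 0" "e < d" "e \<le> pi" using d(1) by (auto simp: e_def)
      have arc: "?c ` {t0 - e..t0 + e} \<subseteq> unit_disc"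
        using d(2) e by (force simp: dist_real_def)
      have "convex_arc (t0 - e) (t0 + e) (F \<circ> ?c)"
        using U \<zeta> \<rho> e arc unfolding class_UCV_def by (smt (verit) mem_Collect_eq)
      from curvature_nonneg_if_convex_arc[OF hol _ \<rho> arc _ _ this, of t0] show ?thesis
        using ne[OF z] e unfolding z0 by simp
    qed simp
  next
    assume "F \<in> class_S \<and> (\<forall>\<zeta>\<in>unit_disc. \<forall>z\<in>unit_disc.
      Re (1 + (z - \<zeta>) * deriv (deriv F) z / deriv F z) \<ge> 0)"
    then show "F \<in> class_UCV" unfolding class_UCV_def
      using convex_arc_if_curvature_nonneg[OF hol ne] by simp
  qed (use True in simp)
qed (simp add: class_UCV_def)

section \<open>Sharp radii\<close>

text \<open>
  The primitive of \<open>(1 + z)\<^sup>2 / (1 - z) = 4 / (1 - z) - 3 - z\<close> that vanishes at the origin; it belongs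
  to the self-maps \<open>w = h = z\<close>.
\<close>

definition F4_extremal :: "complex \<Rightarrow> complex" where
  "F4_extremal z = - z\<^sup>2 / 2 - 3 * z - 4 * Ln (1 - z)"

lemma one_minus_not_nonpos_real:
  fixes z :: complex
  shows "norm z < 1 \<Longrightarrow> 1 - z \<notin> \<real>\<^sub>\<le>\<^sub>0"
  using complex_Re_le_cmod[of z] by (auto simp: complex_nonpos_Reals_iff)

lemma Ln_one_minus_has_field_derivative:
  assumes "norm z < 1"
  shows "((\<lambda>z. Ln (1 - z)) has_field_derivative - 1 / (1 - z)) (at z)"
  using one_minus_not_nonpos_real[OF assms]
  by (auto intro!: derivative_eq_intros simp: divide_simps)

lemma F4_extremal_deriv:
  assumes z: "norm z < 1"
  shows "(F4_extremal has_field_derivative (1 + z)\<^sup>2 / (1 - z)) (at z)"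
    and "deriv F4_extremal z = (1 + z)\<^sup>2 / (1 - z)"
proof -
  have "1 - z \<noteq> 0" using z by auto
  note L = Ln_one_minus_has_field_derivative[OF z]
  have "(F4_extremal has_field_derivative - z - 3 - 4 * (- 1 / (1 - z))) (at z)"
    unfolding F4_extremal_def[abs_def]
    by (rule L derivative_eq_intros refl | simp)+
  moreover have "- z - 3 - 4 * (- 1 / (1 - z)) = (1 + z)\<^sup>2 / (1 - z)"
    using \<open>1 - z \<noteq> 0\<close> by (simp add: divide_simps power2_eq_square) (simp add: algebra_simps)
  ultimately show "(F4_extremal has_field_derivative (1 + z)\<^sup>2 / (1 - z)) (at z)" by simp
  then show "deriv F4_extremal z = (1 + z)\<^sup>2 / (1 - z)" by (rule DERIV_imp_deriv)
qed

text \<open>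
  The witness \<open>g\<close> is the primitive of the half-plane map \<open>(1 + z) / (1 - z)\<close>, for which
  \<open>f' / g' - 1\<close> is the identity.
\<close>

lemma F4_extremal_in_F4: "F4_extremal \<in> class_F4"
proof -
  define g :: "complex \<Rightarrow> complex" where "g z = - z - 2 * Ln (1 - z)" for z
  have ne: "1 - z \<noteq> 0" if "norm z < 1" for z :: complex using that by auto
  have dg: "(g has_field_derivative (1 + z) / (1 - z)) (at z)" if "norm z < 1" for z
  proof -
    note L = Ln_one_minus_has_field_derivative[OF that]
    have "(g has_field_derivative - 1 - 2 * (- 1 / (1 - z))) (at z)"
      unfolding g_def[abs_def] by (rule L derivative_eq_intros refl | simp)+
    moreover have "- 1 - 2 * (- 1 / (1 - z)) = (1 + z) / (1 - z)"
      using ne[OF that] by (simp add: divide_simps)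
    ultimately show ?thesis by simp
  qed
  then have dg': "deriv g z = (1 + z) / (1 - z)" if "norm z < 1" for z
    using that DERIV_imp_deriv by blast
  have "g holomorphic_on unit_disc" "F4_extremal holomorphic_on unit_disc"
    using dg F4_extremal_deriv(1) by (force simp: holomorphic_on_open)+
  then have A: "g \<in> class_A" "F4_extremal \<in> class_A"
    using dg'[of 0] F4_extremal_deriv(2)[of 0]
    by (auto simp: class_A_def g_def F4_extremal_def)
  have "Re (deriv g z) > 0" "norm (deriv F4_extremal z / deriv g z - 1) < 1" if "norm z < 1" for z
  proof -
    have "(norm z)\<^sup>2 < 1" using that by (simp add: power_less_one_iff)
    then have "Re ((1 + z) * cnj (1 - z)) > 0"
      unfolding cmod_power2 by (simp add: power2_eq_square algebra_simps)
    then have "Re ((1 + z) * cnj (1 - z) / of_real ((norm (1 - z))\<^sup>2)) > 0"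
      unfolding Re_divide_of_real using ne[OF that] by simp
    moreover have "(1 + z) / (1 - z) = (1 + z) * cnj (1 - z) / of_real ((norm (1 - z))\<^sup>2)"
      by (rule complex_div_cnj)
    ultimately show "Re (deriv g z) > 0" unfolding dg'[OF that] by metis
    have "1 + z \<noteq> 0" using that by (auto simp: add_eq_0_iff)
    then have "deriv F4_extremal z / deriv g z - 1 = z"
      unfolding dg'[OF that] F4_extremal_deriv(2)[OF that] using ne[OF that]
      by (simp add: divide_simps power2_eq_square)
    then show "norm (deriv F4_extremal z / deriv g z - 1) < 1" using that by simp
  qed
  with A show ?thesis unfolding class_F4_def by (auto intro!: bexI[of _ g])
qed

lemma F4_extremal_dilation:
  assumes r: "0 < r" "r \<le> 1" and s: "0 < s" "s < 1"
  defines "F \<equiv> dilation r F4_extremal"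
  shows "- of_real s * deriv (deriv F) (- of_real s) / deriv F (- of_real s) =
    - of_real (r * s * (3 + r * s) / (1 - (r * s)\<^sup>2))"
proof -
  let ?x = "- of_real (r * s) :: complex"
  have rs: "r * s < 1" "r * s > 0"
    using r s mult_le_less_imp_less[of r 1 s 1] by auto
  have A: "F4_extremal \<in> class_A" using F4_extremal_in_F4 by (simp add: class_F4_def)
  have x: "norm ?x < 1" using rs r s by (simp add: norm_mult)
  have ne: "1 - ?x \<noteq> 0" "1 + ?x \<noteq> 0" using rs x by (auto simp: add_eq_0_iff)
  have "((\<lambda>z. (1 + z)\<^sup>2 / (1 - z)) has_field_derivative
      (2 * (1 + ?x) * (1 - ?x) + (1 + ?x)\<^sup>2) / (1 - ?x)\<^sup>2) (at ?x)"
    using ne by (auto intro!: derivative_eq_intros simp: power2_eq_square)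
  then have "(deriv F4_extremal has_field_derivative
      (2 * (1 + ?x) * (1 - ?x) + (1 + ?x)\<^sup>2) / (1 - ?x)\<^sup>2) (at ?x)"
    by (rule has_field_derivative_transform_within_open[of _ _ _ "ball 0 1"])
       (use x F4_extremal_deriv(2) in auto)
  then have d2: "deriv (deriv F4_extremal) ?x = (2 * (1 + ?x) * (1 - ?x) + (1 + ?x)\<^sup>2) / (1 - ?x)\<^sup>2"
    by (rule DERIV_imp_deriv)
  have n: "norm (- of_real s :: complex) < 1" using s by simp
  have "- of_real s * deriv (deriv F) (- of_real s) / deriv F (- of_real s) =
      ?x * deriv (deriv F4_extremal) ?x / deriv F4_extremal ?x"
    unfolding F_def dilation_class_A(2,3)[OF A r n] by simp
  also have "\<dots> = ?x * (3 - ?x) / (1 - ?x\<^sup>2)"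
  proof -
    have "1 - ?x\<^sup>2 = (1 - ?x) * (1 + ?x)" by (simp add: power2_eq_square algebra_simps)
    moreover have "\<And>x :: complex. 1 - x \<noteq> 0 \<Longrightarrow> 1 + x \<noteq> 0 \<Longrightarrow>
      x * ((2 * (1 + x) * (1 - x) + (1 + x)\<^sup>2) / (1 - x)\<^sup>2) / ((1 + x)\<^sup>2 / (1 - x)) =
      x * (3 - x) / ((1 - x) * (1 + x))"
      by (simp add: divide_simps power2_eq_square) (simp add: algebra_simps)
    ultimately show ?thesis unfolding d2 F4_extremal_deriv(2)[OF x] using ne by metis
  qed
  also have "\<dots> = - of_real (r * s * (3 + r * s) / (1 - (r * s)\<^sup>2))" by simp
  finally show ?thesis .
qed

lemma F4_bound_strict_mono:
  fixes x y :: real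
  assumes "0 \<le> x" "x < y" "y < 1"
  shows "(3 + x) / (1 - x\<^sup>2) < (3 + y) / (1 - y\<^sup>2)"
    and "x * (3 + x) / (1 - x\<^sup>2) < y * (3 + y) / (1 - y\<^sup>2)"
proof -
  have y: "1 - y\<^sup>2 > 0" using assms by (simp add: power_less_one_iff)
  have "x\<^sup>2 < y\<^sup>2" using assms by (simp add: power_strict_mono)
  then show *: "(3 + x) / (1 - x\<^sup>2) < (3 + y) / (1 - y\<^sup>2)"
    using y assms by (intro frac_less) auto
  show "x * (3 + x) / (1 - x\<^sup>2) < y * (3 + y) / (1 - y\<^sup>2)"
    using mult_le_less_imp_less[of x y, OF _ *] assms
      mult_strict_mono[OF assms(2) *] y \<open>x\<^sup>2 < y\<^sup>2\<close> by simp
qed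

text \<open>
  The first estimate has no factor \<open>z\<close>: dilation by \<open>r\<close> multiplies \<open>f'' / f'\<close> by \<open>r\<close>, which already
  supplies the factor \<open>R\<close>. It is what uniform convexity needs, since the centre \<open>\<zeta>\<close> may lie far
  from the origin while \<open>z\<close> is close to it. The second is strict because \<open>r z\<close> stays inside the open
  disc of radius \<open>R\<close>.
\<close>

lemma F4_dilation_bound:
  assumes f: "f \<in> class_F4" and r: "0 < r" "r \<le> R" "R < 1" and z: "norm z < 1"
  defines "F \<equiv> dilation r f"
  shows "norm (deriv (deriv F) z / deriv F z) \<le> R * (3 + R) / (1 - R\<^sup>2)"
    and "norm (z * deriv (deriv F) z / deriv F z) < R * (3 + R) / (1 - R\<^sup>2)"
proof -
  let ?x = "of_real r * z" and ?B = "\<lambda>x :: real. (3 + x) / (1 - x\<^sup>2)"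
  have fA: "f \<in> class_A" using f by (simp add: class_F4_def)
  have R: "R > 0" "1 - R\<^sup>2 > 0" using r by (auto simp: power_less_one_iff)
  have nx: "norm ?x = r * norm z" using r by (simp add: norm_mult)
  have xR: "norm ?x < R" unfolding nx
    using mult_strict_left_mono[OF z r(1)] r(2) by linarith
  have F: "deriv (deriv F) z / deriv F z = of_real r * (deriv (deriv f) ?x / deriv f ?x)"
    unfolding F_def using dilation_class_A(2,3)[OF fA r(1) _ z] r by simp
  have b: "norm (deriv (deriv f) ?x / deriv f ?x) \<le> ?B (norm ?x)"
    by (rule F4_logarithmic_derivative_bound[OF f]) (use xR r in simp)
  have "norm (deriv (deriv F) z / deriv F z) = r * norm (deriv (deriv f) ?x / deriv f ?x)"
    unfolding F norm_mult using r by simp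
  also have "\<dots> \<le> r * ?B (norm ?x)" by (rule mult_left_mono[OF b]) (use r in simp)
  also have "\<dots> \<le> R * ?B R"
  proof (rule mult_mono)
    show "?B (norm ?x) \<le> ?B R" using F4_bound_strict_mono(1)[of "norm ?x" R] xR r by simp
    show "?B (norm ?x) \<ge> 0" using order.trans[OF norm_ge_zero b] .
  qed (use r R in auto)
  finally show 1: "norm (deriv (deriv F) z / deriv F z) \<le> R * (3 + R) / (1 - R\<^sup>2)"
    using R by simp
  have "z * deriv (deriv F) z / deriv F z = ?x * (deriv (deriv f) ?x / deriv f ?x)"
    using arg_cong[OF F, of "(*) z"] by (simp add: mult_ac)
  then have "norm (z * deriv (deriv F) z / deriv F z) = norm (?x * (deriv (deriv f) ?x / deriv f ?x))"
    by simp
  also have "\<dots> \<le> norm ?x * ?B (norm ?x)"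
    unfolding norm_mult[of ?x] by (rule mult_left_mono[OF b]) simp
  also have "\<dots> < R * (3 + R) / (1 - R\<^sup>2)"
    using F4_bound_strict_mono(2)[of "norm ?x" R] xR r by simp
  finally show "norm (z * deriv (deriv F) z / deriv F z) < R * (3 + R) / (1 - R\<^sup>2)" .
qed

text \<open>
  Sharpness: for the dilation \<open>F\<close> of the extremal function by \<open>R' > R\<close>, the quantity
  \<open>1 + z F'' / F'\<close> equals \<open>\<alpha>\<close> at the point \<open>z = - R / R'\<close> of the disc, whereas it would have to exceed
  \<open>\<alpha>\<close> there.
\<close>

lemma is_radius_convex_F4:
  assumes R: "0 < R" "R \<le> 1 / 3" and eq: "R * (3 + R) / (1 - R\<^sup>2) = 1 - \<alpha>"
  shows "is_radius (class_C \<alpha>) class_F4 R"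
  unfolding is_radius_def
proof (intro conjI allI impI)
  have "dilation r f \<in> class_C \<alpha>" if r: "0 < r" "r \<le> R" and f: "f \<in> class_F4" for r f
  proof -
    let ?F = "dilation r f"
    have "Re (1 + z * deriv (deriv ?F) z / deriv ?F z) > \<alpha>" if "norm z < 1" for z
      using F4_dilation_bound(2)[OF f r _ that] R
        abs_Re_le_cmod[of "z * deriv (deriv ?F) z / deriv ?F z"] unfolding eq by simp
    then show ?thesis using F4_dilation_class_S[OF f r(1)] r R by (auto simp: class_C_def)
  qed
  then show "radius_admissible (class_C \<alpha>) class_F4 R"
    using R by (simp add: radius_admissible_def)
next
  fix R' assume adm: "radius_admissible (class_C \<alpha>) class_F4 R'"
  show "R' \<le> R"
  proof (rule ccontr)
    assume "\<not> R' \<le> R"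
    then have R': "0 < R'" "R' \<le> 1" "R < R'" using adm R by (auto simp: radius_admissible_def)
    define s where "s = R / R'"
    have s: "0 < s" "s < 1" "R' * s = R" using R R' by (auto simp: s_def)
    have "dilation R' F4_extremal \<in> class_C \<alpha>"
      using adm R' F4_extremal_in_F4 by (simp add: radius_admissible_def)
    then have "\<forall>z\<in>unit_disc. Re (1 + z * deriv (deriv (dilation R' F4_extremal)) z /
        deriv (dilation R' F4_extremal) z) > \<alpha>"
      by (simp add: class_C_def)
    moreover have "- of_real s \<in> unit_disc" using s by simp
    ultimately have "Re (1 + - of_real s * deriv (deriv (dilation R' F4_extremal)) (- of_real s) /
        deriv (dilation R' F4_extremal) (- of_real s)) > \<alpha>"
      by (rule bspec)
    then show False
      unfolding F4_extremal_dilation[OF R'(1,2) s(1,2)] s(3) eq by simp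
  qed
qed

text \<open>
  Sharpness: \<open>class_UCV_iff\<close> is a weak inequality, so the point \<open>- s\<close> is taken with \<open>R' s > R\<close>; the
  centre \<open>\<zeta> = s\<close> opposite to it doubles \<open>z F'' / F'\<close>.
\<close>

lemma is_radius_UCV_F4:
  assumes R: "0 < R" "R \<le> 1 / 3" and eq: "R * (3 + R) / (1 - R\<^sup>2) = 1 / 2"
  shows "is_radius class_UCV class_F4 R"
  unfolding is_radius_def
proof (intro conjI allI impI)
  have "dilation r f \<in> class_UCV" if r: "0 < r" "r \<le> R" and f: "f \<in> class_F4" for r f
  proof -
    let ?F = "dilation r f"
    have "Re (1 + (z - \<zeta>) * deriv (deriv ?F) z / deriv ?F z) \<ge> 0"
      if z: "norm z < 1" and \<zeta>: "norm \<zeta> < 1" for z \<zeta>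
    proof -
      have "norm (deriv (deriv ?F) z / deriv ?F z) \<le> 1 / 2"
        using F4_dilation_bound(1)[OF f r _ z] R unfolding eq by simp
      moreover have "norm (z - \<zeta>) \<le> 2" using norm_triangle_ineq4[of z \<zeta>] z \<zeta> by simp
      ultimately have "norm ((z - \<zeta>) * (deriv (deriv ?F) z / deriv ?F z)) \<le> 2 * (1 / 2)"
        unfolding norm_mult by (intro mult_mono) auto
      then show ?thesis
        using abs_Re_le_cmod[of "(z - \<zeta>) * (deriv (deriv ?F) z / deriv ?F z)"] by simp
    qed
    then show ?thesis using F4_dilation_class_S[OF f r(1)] r R by (auto simp: class_UCV_iff)
  qed
  then show "radius_admissible class_UCV class_F4 R"
    using R by (simp add: radius_admissible_def)
next
  fix R' assume adm: "radius_admissible class_UCV class_F4 R'"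
  show "R' \<le> R"
  proof (rule ccontr)
    assume "\<not> R' \<le> R"
    then have R': "0 < R'" "R' \<le> 1" "R < R'" using adm R by (auto simp: radius_admissible_def)
    obtain s where s0: "R / R' < s" "s < 1" using dense[of "R / R'" 1] R' by auto
    have "0 < s" using s0 R R' by (smt (verit) divide_pos_pos)
    have Rs: "R < R' * s" using s0 R' by (simp add: divide_simps mult.commute)
    have s1: "R' * s < 1" using R' s0 mult_le_less_imp_less[of R' 1 s 1] \<open>0 < s\<close> by simp
    let ?F = "dilation R' F4_extremal" and ?z = "- of_real s :: complex"
    have "?F \<in> class_UCV"
      using adm R' F4_extremal_in_F4 by (simp add: radius_admissible_def)
    moreover have "?z \<in> unit_disc" "- ?z \<in> unit_disc" using s0 \<open>0 < s\<close> by simp_all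
    ultimately have "Re (1 + (?z - (- ?z)) * deriv (deriv ?F) ?z / deriv ?F ?z) \<ge> 0"
      unfolding class_UCV_iff by blast
    moreover have "(?z - (- ?z)) * deriv (deriv ?F) ?z / deriv ?F ?z =
        2 * (?z * deriv (deriv ?F) ?z / deriv ?F ?z)" by simp
    ultimately have "Re (1 + 2 * - of_real (R' * s * (3 + R' * s) / (1 - (R' * s)\<^sup>2))) \<ge> 0"
      by (simp only: F4_extremal_dilation[OF R'(1,2) \<open>0 < s\<close> s0(2)])
    moreover have "c \<le> 1 / 2" if "Re (1 + 2 * - of_real c) \<ge> 0" for c using that by simp
    ultimately have "R' * s * (3 + R' * s) / (1 - (R' * s)\<^sup>2) \<le> 1 / 2" by blast
    moreover have "1 / 2 < R' * s * (3 + R' * s) / (1 - (R' * s)\<^sup>2)"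
      using F4_bound_strict_mono(2)[OF _ Rs s1] R unfolding eq by simp
    ultimately show False by simp
  qed
qed

text \<open>
  The expression is the positive root of \<open>(2 - \<alpha>) R\<^sup>2 + 3 R - (1 - \<alpha>) = 0\<close> with rationalised
  numerator; the bound \<open>1 / 3\<close> holds because the square root is at least \<open>3\<close>.
\<close>

lemma F4_radius_formula:
  fixes \<alpha> :: real
  assumes \<alpha>: "0 \<le> \<alpha>" "\<alpha> < 1"
  defines "R \<equiv> 2 * (1 - \<alpha>) / (3 + sqrt (9 + 4 * (\<alpha> - 2) * (\<alpha> - 1)))"
  shows "0 < R" "R \<le> 1 / 3" "R * (3 + R) / (1 - R\<^sup>2) = 1 - \<alpha>"
proof -
  define q where "q = sqrt (9 + 4 * (\<alpha> - 2) * (\<alpha> - 1))"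
  have pos: "(\<alpha> - 2) * (\<alpha> - 1) \<ge> 0" using \<alpha> by (simp add: mult_nonpos_nonpos)
  then have "9 + 4 * (\<alpha> - 2) * (\<alpha> - 1) \<ge> 9" unfolding mult.assoc by linarith
  then have "q \<ge> 3" and q2: "q\<^sup>2 = 9 + 4 * (\<alpha> - 2) * (\<alpha> - 1)"
    unfolding q_def by (auto intro: real_le_rsqrt)
  have R: "R = 2 * (1 - \<alpha>) / (3 + q)" by (simp add: R_def q_def)
  show "0 < R" unfolding R using \<alpha> \<open>q \<ge> 3\<close> by simp
  show R3: "R \<le> 1 / 3" unfolding R using \<alpha> \<open>q \<ge> 3\<close> by (simp add: divide_simps)
  have "R * (3 + q) = 2 * (1 - \<alpha>)" unfolding R using \<open>q \<ge> 3\<close> by simp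
  \<comment> \<open>The same root in its usual form; solving for \<open>q\<close> and inserting it above gives the equation for \<open>R\<close>.\<close>
  moreover have "2 * (2 - \<alpha>) * R = q - 3"
    unfolding R using \<open>q \<ge> 3\<close> q2 by (simp add: divide_simps power2_eq_square algebra_simps)
  ultimately have "R * (3 + R) = (1 - \<alpha>) * (1 - R\<^sup>2)" by algebra
  moreover have "1 - R\<^sup>2 > 0" using \<open>0 < R\<close> R3 by (simp add: power_less_one_iff)
  ultimately show "R * (3 + R) / (1 - R\<^sup>2) = 1 - \<alpha>" by (simp add: divide_simps)
qed

theorem theorem2p4:
  shows "(\<forall>\<alpha>::real. 0 \<le> \<alpha> \<and> \<alpha> < 1 \<longrightarrow>
            is_radius (class_C \<alpha>) class_F4
              (2 * (1 - \<alpha>) / (3 + sqrt (9 + 4 * (\<alpha> - 2) * (\<alpha> - 1))))) \<and>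
         is_radius class_UCV class_F4 ((2 * sqrt 3 - 3) / 3) \<and>
         is_radius (class_C (1 / 2)) class_F4 ((2 * sqrt 3 - 3) / 3)"
proof -
  have "sqrt 12 = 2 * sqrt 3" using real_sqrt_mult[of 4 3] by simp
  moreover have "2 * (1 - 1 / 2) / (3 + sqrt (9 + 4 * (1 / 2 - 2) * (1 / 2 - 1))) = 1 / (3 + sqrt 12)"
    by simp
  moreover have "1 / (3 + 2 * sqrt 3) = (2 * sqrt 3 - 3) / 3"
  proof -
    have "3 + 2 * sqrt 3 > 0" using real_sqrt_ge_zero[of 3] by linarith
    then show ?thesis by (simp add: divide_simps algebra_simps)
  qed
  ultimately have half: "2 * (1 - 1 / 2) / (3 + sqrt (9 + 4 * (1 / 2 - 2) * (1 / 2 - 1))) = (2 * sqrt 3 - 3) / 3"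
    by simp
  define R where "R = (2 * sqrt 3 - 3) / 3"
  have R: "0 < R" "R \<le> 1 / 3" "R * (3 + R) / (1 - R\<^sup>2) = 1 - 1 / 2"
    by (rule F4_radius_formula[of "1 / 2", unfolded half, folded R_def]; simp)+
  have "is_radius (class_C (1 / 2)) class_F4 R" by (rule is_radius_convex_F4[OF R])
  moreover have "is_radius class_UCV class_F4 R"
    by (rule is_radius_UCV_F4[OF R(1,2)]) (simp only: R(3))
  ultimately show ?thesis
    unfolding R_def using is_radius_convex_F4[OF F4_radius_formula] by blast
qed

end
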